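(* Let $r>0$ be real and let $k_r\in(0,1)$ be the elliptic singular modulus. Then $$\frac{4E(k_r)}{\pi}=\frac{2K(k_r)}{\pi}+\sum_{n=0}^{\infty}\frac{\left(\left(\frac12\right)_n\right)^2}{(n!)^2}\,(k_r)^{2n}\left[4(1-k_r^2)\,n+1-2k_r^2\right].$$
   Context: For $0\le x<1$, the complete elliptic integrals of the first and second kind are $K(x)=\int_0^{\pi/2}\frac{d\theta}{\sqrt{1-x^2\sin^2\theta}}=\frac{\pi}{2}\,{}_2F_1\left(\frac12,\frac12;1;x^2\right)$ and $E(x)=\frac{\pi}{2}\,{}_2F_1\left(-\frac12,\frac12;1;x^2\right)$ (the argument $x$ is the modulus). For $r>0$, the elliptic singular modulus $k_r$ is the unique number in $(0,1)$ with $\frac{K\left(\sqrt{1-k_r^2}\right)}{K(k_r)}=\sqrt{r}$. The Pochhammer symbol is $(a)_n=a(a+1)\cdots(a+n-1)$, $(a)_0=1$. *)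

theory Defs
  imports "HOL-Analysis.Analysis"
begin

(* The Gauss series; meaningful for |z| < 1 and c not a non-positive integer. *)
definition hypergeo_2F1 :: "real \<Rightarrow> real \<Rightarrow> real \<Rightarrow> real \<Rightarrow> real" where
  "hypergeo_2F1 a b c z =
     (\<Sum>n. pochhammer a n * pochhammer b n / (pochhammer c n * fact n) * z ^ n)"

(* In both elliptic integrals the argument is the modulus (not the parameter x^2),
   with 0 <= x < 1. *)
definition elliptic_K :: "real \<Rightarrow> real" where
  "elliptic_K x = integral {0..pi/2} (\<lambda>\<theta>. 1 / sqrt (1 - x\<^sup>2 * (sin \<theta>)\<^sup>2))"

definition elliptic_E :: "real \<Rightarrow> real" where
  "elliptic_E x = pi / 2 * hypergeo_2F1 (- 1/2) (1/2) 1 (x\<^sup>2)"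

definition singular_modulus :: "real \<Rightarrow> real" where
  "singular_modulus r =
     (THE k. 0 < k \<and> k < 1 \<and> elliptic_K (sqrt (1 - k\<^sup>2)) / elliptic_K k = sqrt r)"

end

(* With y = k^2 and a_n = ((1/2)_n / n!)^2, expanding the integrand by the binomial series and
   integrating termwise gives 2 K(k) / pi = sum a_n y^n.  Put c_n = a_n (4 n + 2) y^n.  The right-hand
   side of the claim is (1 - y) times the sum of c_n, i.e. c_0 + sum (c_(n+1) - y c_n), and this agrees
   coefficientwise with twice the hypergeometric series of E.  This holds for all 0 < k < 1.  The
   singular modulus lies in that interval because sum a_n y^n is continuous, strictly increasing and
   unbounded on [0, 1) (as a_n >= 1/(4 n)), so that the quotient defining it attains every positive
   value exactly once. *)

theory Submission
  imports Defs
begin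

section \<open>The coefficients of the series for K: recurrence and bounds\<close>

lemma pochhammer_half_over_fact_le_1: "pochhammer (1/2) n / fact n \<le> (1::real)"
proof -
  have "pochhammer (1/2) n \<le> (fact n :: real)"
  proof (induction n)
    case (Suc n)
    have "pochhammer (1/2) n * (1/2 + real n) \<le> fact n * (1 + real n)"
      using Suc by (intro mult_mono) (auto intro: less_imp_le pochhammer_pos)
    then show ?case
      by (simp add: pochhammer_Suc algebra_simps)
  qed simp
  then show ?thesis
    by simp
qed

text \<open>The coefficient of y^n in 2F1(1/2, 1/2; 1; y), equal to (binomial(2n, n) /
  4^n)^2.\<close>

definition K_coeff :: "nat \<Rightarrow> real" where
  "K_coeff n = (pochhammer (1/2) n / fact n)\<^sup>2"

lemma K_coeff_0 [simp]: "K_coeff 0 = 1"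
  by (simp add: K_coeff_def)

lemma K_coeff_Suc: "K_coeff (Suc n) = K_coeff n * ((real n + 1/2) / (real n + 1))\<^sup>2"
  by (simp add: K_coeff_def pochhammer_Suc power_mult_distrib power_divide ac_simps)

lemma K_coeff_pos: "K_coeff n > 0"
  using pochhammer_pos[of "1/2 :: real" n] by (simp add: K_coeff_def)

lemma K_coeff_le_1: "K_coeff n \<le> 1"
  unfolding K_coeff_def
proof (rule power_le_one)
  show "0 \<le> pochhammer (1/2) n / (fact n :: real)"
    using pochhammer_pos[of "1/2 :: real" n] by simp
qed (rule pochhammer_half_over_fact_le_1)

text \<open>With m = n + 1, the recurrence preserves the bound because m (m + 1) \<le> (m + 1/2)^2;
  the first case is an equality. Comparison with the harmonic series will make the power series
  unbounded near 1.\<close>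

lemma K_coeff_ge: "K_coeff (Suc n) \<ge> 1 / (4 * real (Suc n))"
proof (induction n)
  case 0
  show ?case by (simp add: K_coeff_Suc power2_eq_square)
next
  case (Suc n)
  have "1 / (4 * real (Suc (Suc n)))
      \<le> 1 / (4 * real (Suc n)) * ((real (Suc n) + 1/2) / (real (Suc n) + 1))\<^sup>2"
  proof -
    define m where "m = real (Suc n)"
    have m: "m > 0"
      by (simp add: m_def)
    have "1 / (4 * (m + 1)) = m * (m + 1) / (4 * m * (m + 1)\<^sup>2)"
      using m by (simp add: power2_eq_square)
    also have "\<dots> \<le> (m + 1/2)\<^sup>2 / (4 * m * (m + 1)\<^sup>2)"
      using m by (intro divide_right_mono) (auto simp: power2_eq_square algebra_simps)
    also have "\<dots> = 1 / (4 * m) * ((m + 1/2) / (m + 1))\<^sup>2"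
      by (simp add: power_divide)
    finally show ?thesis
      by (simp add: m_def add.commute)
  qed
  also have "\<dots> \<le> K_coeff (Suc n) * ((real (Suc n) + 1/2) / (real (Suc n) + 1))\<^sup>2"
    by (rule mult_right_mono[OF Suc]) simp
  finally show ?case
    by (simp only: K_coeff_Suc[of "Suc n"])
qed

section \<open>Convergence, monotonicity, continuity and growth of the power series\<close>

lemma summable_K_coeff:
  assumes "0 \<le> y" "y < 1"
  shows "summable (\<lambda>n. K_coeff n * y ^ n)"
proof (rule summable_comparison_test'[of "\<lambda>n. y ^ n" 0])
  show "norm (K_coeff n * y ^ n) \<le> y ^ n" for n
    using assms K_coeff_pos[of n] K_coeff_le_1[of n]
    by (simp add: abs_mult mult_left_le_one_le)
qed (use assms in auto)

text \<open>The majorant is 4 times the derivative of the geometric series, since 4 n + 2 \<le> 4 (n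
  + 1).\<close>

lemma summable_K_coeff_linear:
  assumes "0 \<le> y" "y < 1"
  shows "summable (\<lambda>n. K_coeff n * (4 * real n + 2) * y ^ n)"
proof (rule summable_comparison_test'[of "\<lambda>n. 4 * (real (Suc n) * y ^ n)" 0])
  show "summable (\<lambda>n. 4 * (real (Suc n) * y ^ n))"
    using geometric_deriv_sums[of y] assms by (intro summable_mult) (auto simp: sums_iff)
  show "norm (K_coeff n * (4 * real n + 2) * y ^ n) \<le> 4 * (real (Suc n) * y ^ n)" for n
  proof -
    have "K_coeff n * (4 * real n + 2) \<le> 1 * (4 * real (Suc n))"
      using K_coeff_le_1[of n] by (intro mult_mono) auto
    then have "K_coeff n * (4 * real n + 2) * y ^ n \<le> (4 * real (Suc n)) * y ^ n"
      using assms by (intro mult_right_mono) auto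
    then show ?thesis
      using assms K_coeff_pos[of n] by (simp add: abs_mult mult.assoc distrib_left distrib_right)
  qed
qed

text \<open>The variable is the squared modulus y = k^2, so that passing to the complementary
  modulus becomes y \<mapsto> 1 - y.\<close>

definition K_series :: "real \<Rightarrow> real" where
  "K_series y = (\<Sum>n. K_coeff n * y ^ n)"

lemma K_series_strict_mono:
  assumes "0 \<le> x" "x < y" "y < 1"
  shows "K_series x < K_series y"
proof -
  have summable: "summable (\<lambda>n. K_coeff n * x ^ n)" "summable (\<lambda>n. K_coeff n * y ^ n)"
    using assms by (auto intro: summable_K_coeff)
  have "0 < (\<Sum>n. K_coeff n * y ^ n - K_coeff n * x ^ n)"
  \<comment> \<open>The constant terms cancel, so strictness has to come from the linear
    term.\<close>
  proof (rule suminf_pos2[of _ 1])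
    show "0 \<le> K_coeff n * y ^ n - K_coeff n * x ^ n" for n
      using assms K_coeff_pos[of n] by (simp add: mult_left_mono power_mono)
    show "0 < K_coeff 1 * y ^ 1 - K_coeff 1 * x ^ 1"
      using assms K_coeff_pos[of 1] by simp
  qed (intro summable_diff summable)
  then show ?thesis
    using suminf_diff[OF summable(2,1)] by (simp add: K_series_def)
qed

lemma K_series_pos:
  assumes "0 \<le> y" "y < 1"
  shows "K_series y > 0"
  unfolding K_series_def
proof (rule suminf_pos2[of _ 0])
  show "0 \<le> K_coeff n * y ^ n" for n
    using assms K_coeff_pos[of n] by simp
qed (use assms in \<open>simp_all add: summable_K_coeff\<close>)

lemma continuous_on_K_series: "continuous_on {0..<1} K_series"
proof -
  have "isCont K_series y" if "0 \<le> y" "y < 1" for y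
    unfolding K_series_def
    \<comment> \<open>The midpoint of y and 1 is a point of convergence beyond y.\<close>
    by (rule isCont_powser[OF summable_K_coeff[of "(1 + y) / 2"]]) (use that in auto)
  then show ?thesis
    by (auto intro!: continuous_at_imp_continuous_on)
qed

text \<open>For y close enough to 1, the powers y^1, ..., y^N are all at least 1/2, so the partial
  sum up to N is at least \<open>harm N / 8\<close>: a factor 4 from \<open>K_coeff_ge\<close> and a
  factor 2 from the powers.\<close>

lemma K_series_unbounded: "\<exists>y. 1/2 \<le> y \<and> y < 1 \<and> M \<le> K_series y"
proof -
  have "eventually (\<lambda>N. 8 * \<bar>M\<bar> \<le> harm N) sequentially"
    using harm_at_top by (simp add: filterlim_at_top)
  then obtain N where N: "N > 0" and harm: "8 * \<bar>M\<bar> \<le> harm N"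
    using eventually_happens'[OF _ eventually_conj[OF _ eventually_gt_at_top[of 0]]] by auto
  \<comment> \<open>This choice makes the smallest of the powers, y^N, exactly 1/2.\<close>
  define y :: real where "y = root N (1/2)"
  have y: "y ^ N = 1/2" "0 < y" "y < 1"
    using N by (simp_all add: y_def)
  have "y ^ N \<le> y ^ 1"
    using N y by (intro power_decreasing) auto
  then have y_ge: "1/2 \<le> y"
    using y by simp
  have "M \<le> (1/8) * harm N"
    using harm by linarith
  also have "\<dots> = (\<Sum>n=1..N. 1 / (4 * real n) * (1/2))"
    by (simp add: harm_def sum_distrib_left field_simps)
  also have "\<dots> \<le> (\<Sum>n=1..N. K_coeff n * y ^ n)"
  proof (intro sum_mono mult_mono)
    fix n assume n: "n \<in> {1..N}"
    show "1 / (4 * real n) \<le> K_coeff n"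
      using K_coeff_ge[of "n - 1"] n by simp
    show "1/2 \<le> y ^ n"
      using power_decreasing[of n N y] n y by simp
  qed (auto simp: K_coeff_pos less_imp_le)
  also have "\<dots> \<le> K_series y"
    unfolding K_series_def using y K_coeff_pos
    by (intro sum_le_suminf summable_K_coeff) (auto simp: less_imp_le)
  finally show ?thesis
    using y y_ge by blast
qed

section \<open>The quotient of the series at complementary arguments\<close>

text \<open>On [1/2, 1) the numerator stays below its value at 1/2 while the denominator is
  unbounded.\<close>

lemma K_series_quotient_le:
  assumes "c > 0"
  shows "\<exists>y. 1/2 \<le> y \<and> y < 1 \<and> K_series (1 - y) \<le> c * K_series y"
proof -
  obtain y where y: "1/2 \<le> y" "y < 1" "K_series (1/2) / c \<le> K_series y"
    using K_series_unbounded by blast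
  have "K_series (1 - y) \<le> K_series (1/2)"
  proof (cases "y = 1/2")
    case False
    then show ?thesis
      using K_series_strict_mono[of "1 - y" "1/2"] y by simp
  next
    case True
    then have "1 - y = 1/2" by simp
    then show ?thesis by (simp only: order_refl)
  qed
  also have "\<dots> \<le> c * K_series y"
    using y assms by (simp add: field_simps)
  finally show ?thesis
    using y by blast
qed

text \<open>Existence follows from the intermediate value theorem, uniqueness from strict
  monotonicity of the quotient.\<close>

lemma K_series_quotient_ex1:
  assumes "c > 0"
  shows "\<exists>!y. 0 < y \<and> y < 1 \<and> K_series (1 - y) / K_series y = c"
proof -
  obtain b where b: "1/2 \<le> b" "b < 1" "K_series (1 - b) \<le> c * K_series b"
    using K_series_quotient_le assms by blast
  \<comment> \<open>Replacing y by 1 - y inverts the quotient, so the bound for 1/c, reflected,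
    yields a point where the quotient is at least c.\<close>
  obtain a' where a': "1/2 \<le> a'" "a' < 1" "K_series (1 - a') \<le> (1 / c) * K_series a'"
    using K_series_quotient_le[of "1 / c"] assms by auto
  define a where "a = 1 - a'"
  have a: "0 < a" "a \<le> 1/2" "c * K_series a \<le> K_series (1 - a)"
    using a' assms by (auto simp: a_def field_simps)
  have cont: "continuous_on {a..b} (\<lambda>y. K_series (1 - y) / K_series y)"
  proof (intro continuous_on_divide)
    show "continuous_on {a..b} (\<lambda>y. K_series (1 - y))"
      by (rule continuous_on_compose2[OF continuous_on_K_series])
         (use a b in \<open>auto intro!: continuous_intros\<close>)
    show "continuous_on {a..b} K_series"
      by (rule continuous_on_subset[OF continuous_on_K_series]) (use a b in auto)
    show "\<forall>y\<in>{a..b}. K_series y \<noteq> 0"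
    proof
      fix y assume "y \<in> {a..b}"
      then show "K_series y \<noteq> 0"
        using a b K_series_pos[of y] by simp
    qed
  qed
  have "\<exists>y\<ge>a. y \<le> b \<and> K_series (1 - y) / K_series y = c"
  proof (rule IVT2'[OF _ _ _ cont])
    show "K_series (1 - b) / K_series b \<le> c"
      using b K_series_pos[of b] by (simp add: divide_le_eq)
    show "c \<le> K_series (1 - a) / K_series a"
      using a K_series_pos[of a] by (simp add: le_divide_eq)
  qed (use a b in auto)
  then obtain y where "a \<le> y" "y \<le> b" and quotient: "K_series (1 - y) / K_series y = c"
    by blast
  then have y: "0 < y" "y < 1" "K_series (1 - y) / K_series y = c"
    using a b by linarith+
  have less: "K_series (1 - v) / K_series v < K_series (1 - u) / K_series u"
    \<comment> \<open>The quotient decreases strictly: its numerator falls and its denominator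
      grows.\<close>
    if "0 < u" "u < v" "v < 1" for u v
  proof (rule frac_less)
    show "0 \<le> K_series (1 - v)" "0 < K_series u"
      using that K_series_pos[of "1 - v"] K_series_pos[of u] by simp_all
    show "K_series (1 - v) < K_series (1 - u)" "K_series u \<le> K_series v"
      using that K_series_strict_mono[of "1 - v" "1 - u"] K_series_strict_mono[of u v] by simp_all
  qed
  show ?thesis
  proof (rule ex1I[of _ y])
    show "0 < y \<and> y < 1 \<and> K_series (1 - y) / K_series y = c"
      using y by blast
    show "z = y" if "0 < z \<and> z < 1 \<and> K_series (1 - z) / K_series z = c" for z
      using less[of z y] less[of y z] y that by (metis less_irrefl linorder_neqE_linordered_idom)
  qed
qed

section \<open>The power series of the integral K\<close>

text \<open>Wallis' integral. The derivative of sin^(2n+1) cos is a combination of sin^(2n) and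
  sin^(2n+2), and sin^(2n+1) cos vanishes at both endpoints.\<close>

lemma has_integral_sin_power_even:
  "((\<lambda>t. sin t ^ (2 * n)) has_integral pi / 2 * (pochhammer (1/2) n / fact n)) {0..pi/2}"
proof (induction n)
  case 0
  show ?case
    using has_integral_const_real[of "1::real" 0 "pi/2"] by simp
next
  case (Suc n)
  have "((\<lambda>t. (2 * real n + 1) * sin t ^ (2 * n) - (2 * real n + 2) * sin t ^ (2 * Suc n))
      has_integral (sin (pi/2) ^ Suc (2 * n) * cos (pi/2) - sin 0 ^ Suc (2 * n) * cos 0)) {0..pi/2}"
  proof (rule fundamental_theorem_of_calculus)
    fix t :: real
    have "((\<lambda>t. sin t ^ Suc (2 * n) * cos t) has_real_derivative
        real (2 * n + 1) * sin t ^ (2 * n) * cos t * cos t - sin t ^ Suc (2 * n) * sin t)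
        (at t within {0..pi/2})"
    proof -
      have "((\<lambda>t. sin t ^ Suc (2 * n)) has_real_derivative
          (1 + real (2 * n)) * (cos t * sin t ^ (2 * n))) (at t within {0..pi/2})"
        by (intro DERIV_power_Suc) (auto intro!: derivative_eq_intros)
      moreover have "(cos has_real_derivative - sin t) (at t within {0..pi/2})"
        by (auto intro!: derivative_eq_intros)
      ultimately have "((\<lambda>t. sin t ^ Suc (2 * n) * cos t) has_real_derivative
          (1 + real (2 * n)) * (cos t * sin t ^ (2 * n)) * cos t + - sin t * sin t ^ Suc (2 * n))
          (at t within {0..pi/2})"
        by (rule DERIV_mult)
      then show ?thesis
        by (rule DERIV_cong) simp
    qed
    moreover have "real (2 * n + 1) * sin t ^ (2 * n) * cos t * cos t - sin t ^ Suc (2 * n) * sin t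
        = (2 * real n + 1) * sin t ^ (2 * n) - (2 * real n + 2) * sin t ^ (2 * Suc n)"
    proof -
      have "real (2 * n + 1) * sin t ^ (2 * n) * cos t * cos t
          = real (2 * n + 1) * sin t ^ (2 * n) * (1 - sin t * sin t)"
        by (simp only: mult.assoc cos_squared_eq[of t, unfolded power2_eq_square])
      then show ?thesis
        by (simp add: algebra_simps)
    qed
    ultimately show "((\<lambda>t. sin t ^ Suc (2 * n) * cos t) has_vector_derivative
        (2 * real n + 1) * sin t ^ (2 * n) - (2 * real n + 2) * sin t ^ (2 * Suc n))
        (at t within {0..pi/2})"
      by (simp add: has_real_derivative_iff_has_vector_derivative)
  qed simp
  then have "((\<lambda>t. (2 * real n + 1) * sin t ^ (2 * n) - (2 * real n + 2) * sin t ^ (2 * Suc n))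
      has_integral 0) {0..pi/2}"
    by simp
  \<comment> \<open>Solving for the higher power gives the factor (2n + 1) / (2n + 2) = (1/2 + n) /
    (n + 1), as in the quotient of Pochhammer symbol and factorial.\<close>
  from has_integral_diff[OF has_integral_mult_right[OF Suc, of "2 * real n + 1"] this]
  have "((\<lambda>t. (2 * real n + 2) * sin t ^ (2 * Suc n)) has_integral
      (2 * real n + 1) * (pi / 2 * (pochhammer (1/2) n / fact n))) {0..pi/2}"
    by simp
  from has_integral_mult_right[OF this, of "1 / (2 * real n + 2)"]
  have *: "((\<lambda>t. sin t ^ (2 * Suc n)) has_integral
      1 / (2 * real n + 2) * ((2 * real n + 1) * (pi / 2 * (pochhammer (1/2) n / fact n)))) {0..pi/2}"
    by (simp add: add_nonneg_eq_0_iff)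
  have "1 / (2 * real n + 2) * ((2 * real n + 1) * (pi / 2 * (pochhammer (1/2) n / fact n)))
      = pi / 2 * (pochhammer (1/2) (Suc n) / fact (Suc n))"
    by (simp add: pochhammer_Suc divide_simps add_nonneg_eq_0_iff)
       (simp add: algebra_simps)
  with * show ?case
    by simp
qed

text \<open>Binomial series with exponent -1/2 at -z; the sign (-1)^n of the binomial coefficient
  cancels that of (-z)^n.\<close>

lemma inverse_sqrt_series:
  assumes "\<bar>z\<bar> < 1"
  shows "(\<lambda>n. pochhammer (1/2) n / fact n * z ^ n) sums (1 / sqrt (1 - z :: real))"
proof -
  have "(\<lambda>n. ((-1/2) gchoose n) * (-z) ^ n) sums (1 + (-z)) powr (-1/2)"
    using assms by (intro gen_binomial_real) simp
  moreover have "((-1/2) gchoose n) * (-z) ^ n = pochhammer (1/2) n / fact n * z ^ n" for n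
    by (simp add: gbinomial_pochhammer power_minus[of z] flip: power_add mult_2)
  moreover have "(1 + (-z)) powr (-1/2) = 1 / sqrt (1 - z)"
    using assms by (simp add: powr_minus powr_half_sqrt field_simps)
  ultimately show ?thesis
    by simp
qed

text \<open>One factor (1/2)_n / n! comes from the binomial series of the integrand and a second one
  from Wallis' integral, hence the square in \<open>K_coeff\<close>.\<close>

lemma elliptic_K_eq_K_series:
  assumes "0 \<le> x" "x < 1"
  shows "elliptic_K x = pi / 2 * K_series (x\<^sup>2)"
proof -
  have x2: "0 \<le> x\<^sup>2" "x\<^sup>2 < 1"
    using assms by (auto simp: power_less_one_iff abs_square_less_1)
  define f where "f n t = pochhammer (1/2) n / fact n * (x\<^sup>2 * (sin t)\<^sup>2) ^ n" for n and t :: real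
  have bound: "\<bar>x\<^sup>2 * (sin t)\<^sup>2\<bar> \<le> x\<^sup>2" for t :: real
    by (simp add: abs_mult mult_left_le abs_square_le_1)
  have ul: "uniform_limit {0..pi/2} (\<lambda>N t. \<Sum>n<N. f n t) (\<lambda>t. \<Sum>n. f n t) sequentially"
  \<comment> \<open>A geometric majorant independent of t: the coefficients are at most 1 and sin^2
    t \<le> 1. Uniform convergence justifies termwise integration.\<close>
  proof (rule Weierstrass_m_test[where M = "\<lambda>n. (x\<^sup>2) ^ n"])
    fix n and t :: real
    have "norm (f n t) = pochhammer (1/2) n / fact n * \<bar>x\<^sup>2 * (sin t)\<^sup>2\<bar> ^ n"
      by (simp add: f_def abs_mult power_abs pochhammer_pos less_imp_le)
    also have "\<dots> \<le> 1 * (x\<^sup>2) ^ n"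
      using pochhammer_half_over_fact_le_1[of n] bound[of t]
      by (intro mult_mono power_mono) auto
    finally show "norm (f n t) \<le> (x\<^sup>2) ^ n"
      by simp
  qed (use x2 in auto)
  have integral_f: "(f n has_integral pi / 2 * (K_coeff n * (x\<^sup>2) ^ n)) {0..pi/2}" for n
    using has_integral_mult_right[OF has_integral_sin_power_even[of n],
        of "pochhammer (1/2) n / fact n * (x\<^sup>2) ^ n"]
    by (simp add: f_def[abs_def] K_coeff_def power_mult_distrib power2_eq_square power_mult ac_simps)
  have sum_f: "(\<Sum>n. f n t) = 1 / sqrt (1 - x\<^sup>2 * (sin t)\<^sup>2)" for t
    unfolding f_def
    by (rule sums_unique[symmetric], rule inverse_sqrt_series) (use bound[of t] x2 in linarith)
  have integral_sum: "((\<lambda>t. \<Sum>n<N. f n t) has_integral (\<Sum>n<N. pi / 2 * (K_coeff n * (x\<^sup>2) ^ n)))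
      {0..pi/2}" for N
    by (intro has_integral_sum integral_f) auto
  obtain I J where IJ: "\<And>N. ((\<lambda>t. \<Sum>n<N. f n t) has_integral I N) {0..pi/2}"
      "((\<lambda>t. \<Sum>n. f n t) has_integral J) {0..pi/2}" "I \<longlonglongrightarrow> J"
    by (rule uniform_limit_integral[OF ul]) (auto simp: f_def intro!: continuous_intros)
  \<comment> \<open>The integrals \<open>I N\<close> are only known to exist; uniqueness identifies
    them with the computed partial sums.\<close>
  have "I = (\<lambda>N. \<Sum>n<N. pi / 2 * (K_coeff n * (x\<^sup>2) ^ n))"
    using has_integral_unique[OF IJ(1) integral_sum] by auto
  with IJ(3) have "(\<lambda>n. pi / 2 * (K_coeff n * (x\<^sup>2) ^ n)) sums J"
    by (simp add: sums_def)
  moreover have "(\<lambda>n. pi / 2 * (K_coeff n * (x\<^sup>2) ^ n)) sums (pi / 2 * K_series (x\<^sup>2))"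
    unfolding K_series_def using x2 by (intro sums_mult summable_sums summable_K_coeff)
  ultimately have "J = pi / 2 * K_series (x\<^sup>2)"
    by (rule sums_unique2)
  with IJ(2) show ?thesis
    by (simp add: elliptic_K_def sum_f integral_unique)
qed

section \<open>The singular modulus is well defined\<close>

text \<open>The definite description yields information only after unique existence is proved. The
  bijection k \<mapsto> k^2 of (0, 1) transfers it from the quotient of \<open>K_series\<close>, the
  factors pi/2 cancelling.\<close>

lemma singular_modulus_bounds:
  assumes "r > 0"
  shows "0 < singular_modulus r" "singular_modulus r < 1"
proof -
  have quotient: "elliptic_K (sqrt (1 - k\<^sup>2)) / elliptic_K k = K_series (1 - k\<^sup>2) / K_series (k\<^sup>2)"
    if "0 < k" "k < 1" for k
  proof -
    have "0 < k\<^sup>2" "k\<^sup>2 < 1"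
      using that by (auto simp: abs_square_less_1)
    then have "elliptic_K (sqrt (1 - k\<^sup>2)) = pi / 2 * K_series (1 - k\<^sup>2)"
      using elliptic_K_eq_K_series[of "sqrt (1 - k\<^sup>2)"] by simp
    moreover have "elliptic_K k = pi / 2 * K_series (k\<^sup>2)"
      using that by (intro elliptic_K_eq_K_series) auto
    ultimately show ?thesis
      using pi_half_neq_zero by (metis mult_divide_mult_cancel_left)
  qed
  obtain y where y: "0 < y" "y < 1" "K_series (1 - y) / K_series y = sqrt r"
    and unique: "\<And>z. 0 < z \<Longrightarrow> z < 1 \<Longrightarrow> K_series (1 - z) / K_series z = sqrt r \<Longrightarrow> z = y"
    using K_series_quotient_ex1[of "sqrt r"] assms by (metis real_sqrt_gt_zero)
  have "\<exists>!k. 0 < k \<and> k < 1 \<and> elliptic_K (sqrt (1 - k\<^sup>2)) / elliptic_K k = sqrt r"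
  proof (rule ex1I[of _ "sqrt y"])
    show "0 < sqrt y \<and> sqrt y < 1 \<and>
        elliptic_K (sqrt (1 - (sqrt y)\<^sup>2)) / elliptic_K (sqrt y) = sqrt r"
      using y quotient[of "sqrt y"] by simp
    fix k assume k: "0 < k \<and> k < 1 \<and> elliptic_K (sqrt (1 - k\<^sup>2)) / elliptic_K k = sqrt r"
    have "k\<^sup>2 = y"
    proof (rule unique)
      show "0 < k\<^sup>2" "k\<^sup>2 < 1"
        using k by (simp_all add: abs_square_less_1)
      show "K_series (1 - k\<^sup>2) / K_series (k\<^sup>2) = sqrt r"
        using k quotient[of k] by simp
    qed
    then show "k = sqrt y"
      using k by (simp add: real_sqrt_unique)
  qed
  from theI'[OF this] show "0 < singular_modulus r" "singular_modulus r < 1"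
    unfolding singular_modulus_def by blast+
qed

section \<open>The series for E and the final identity\<close>

lemma elliptic_E_sums:
  assumes "0 \<le> k" "k < 1"
  shows "(\<lambda>n. K_coeff n * (4 * real n + 2) * (k\<^sup>2) ^ n * (1 - k\<^sup>2)) sums (4 * elliptic_E k / pi)"
proof -
  define y where "y = k\<^sup>2"
  have y: "0 \<le> y" "y < 1"
    using assms by (auto simp: y_def abs_square_less_1)
  define c where "c n = K_coeff n * (4 * real n + 2) * y ^ n" for n
  define e where "e n = pochhammer (-1/2) n * pochhammer (1/2) n / (pochhammer 1 n * fact n) * y ^ n"
    for n :: nat
  have c: "c sums suminf c"
    using summable_K_coeff_linear[OF y] by (simp add: c_def[abs_def] summable_sums)
  have coeff: "c (Suc n) - y * c n = 2 * e (Suc n)" for n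
  proof -
    \<comment> \<open>Splitting off the first factor turns the remaining ones into those of (1/2)_n,
      so that \<open>e (Suc n)\<close> can be written through \<open>K_coeff n\<close>.\<close>
    have "pochhammer (-1/2) (Suc n) = - (1/2) * pochhammer (1/2 :: real) n"
      by (simp add: pochhammer_rec)
    then have "2 * e (Suc n) = - (K_coeff n * (real n + 1/2) / (real n + 1)\<^sup>2 * y ^ Suc n)"
      by (simp add: e_def K_coeff_def pochhammer_Suc power2_eq_square pochhammer_fact[symmetric]
          ac_simps)
    moreover have "c (Suc n) - y * c n
        = K_coeff n * y ^ Suc n * (((real n + 1/2) / (real n + 1))\<^sup>2 * (4 * real n + 6) - (4 * real n + 2))"
      by (simp add: c_def K_coeff_Suc algebra_simps)
    \<comment> \<open>With m = n + 1 this rests on (m - 1/2) (4 m + 2) = 4 m^2 - 1, which leaves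
      just -1 after 4 m^2 is subtracted.\<close>
    moreover have "((real n + 1/2) / (real n + 1))\<^sup>2 * (4 * real n + 6) - (4 * real n + 2)
        = - ((real n + 1/2) / (real n + 1)\<^sup>2)"
    proof -
      have "real n + 1 \<noteq> 0" by linarith
      then show ?thesis
        by (simp add: divide_simps power2_eq_square) (simp add: algebra_simps)
    qed
    ultimately show ?thesis
      by simp
  qed
  have "(\<lambda>n. c (Suc n)) sums (suminf c - c 0)"
    using c by (simp add: sums_Suc_iff)
  then have "(\<lambda>n. c (Suc n) - y * c n) sums (suminf c - c 0 - y * suminf c)"
    by (intro sums_diff sums_mult c)
  \<comment> \<open>Both leading terms agree: \<open>c 0\<close> and \<open>2 * e 0\<close> equal
    2.\<close>
  then have "(\<lambda>n. 2 * e (Suc n)) sums (suminf c * (1 - y) - 2 * e 0)"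
    by (simp add: coeff) (simp add: c_def e_def algebra_simps)
  then have "(\<lambda>n. 2 * e n) sums (suminf c * (1 - y))"
    by (simp add: sums_Suc_iff[of "\<lambda>n. 2 * e n"])
  from sums_mult[OF this, of "1/2"] have "suminf e = suminf c * (1 - y) / 2"
    by (simp add: sums_iff)
  then have "4 * elliptic_E k / pi = suminf c * (1 - y)"
    by (simp add: elliptic_E_def hypergeo_2F1_def e_def[abs_def] y_def)
  moreover have "(\<lambda>n. c n * (1 - y)) sums (suminf c * (1 - y))"
    by (intro sums_mult2 c)
  ultimately show ?thesis
    by (simp add: c_def y_def)
qed

text \<open>Summability is asserted along with the identity because \<open>suminf\<close> has no
  specified value on a divergent series.\<close>

theorem proposition2:
  fixes r :: real
  assumes "r > 0"
  defines "k \<equiv> singular_modulus r"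
  shows "summable (\<lambda>n. (pochhammer (1/2) n)\<^sup>2 / (fact n)\<^sup>2 * k ^ (2 * n) *
             (4 * (1 - k\<^sup>2) * real n + 1 - 2 * k\<^sup>2)) \<and>
         4 * elliptic_E k / pi = 2 * elliptic_K k / pi +
           (\<Sum>n. (pochhammer (1/2) n)\<^sup>2 / (fact n)\<^sup>2 * k ^ (2 * n) *
             (4 * (1 - k\<^sup>2) * real n + 1 - 2 * k\<^sup>2))"
proof -
  have k: "0 < k" "k < 1"
    using singular_modulus_bounds assms by (auto simp: k_def)
  then have k2: "k\<^sup>2 < 1"
    by (simp add: abs_square_less_1)
  have "(\<lambda>n. K_coeff n * (k\<^sup>2) ^ n) sums K_series (k\<^sup>2)"
    unfolding K_series_def using k2 by (intro summable_sums summable_K_coeff) auto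
  moreover have "K_series (k\<^sup>2) = 2 * elliptic_K k / pi"
    using k by (simp add: elliptic_K_eq_K_series)
  ultimately have "(\<lambda>n. K_coeff n * (4 * real n + 2) * (k\<^sup>2) ^ n * (1 - k\<^sup>2) - K_coeff n * (k\<^sup>2) ^ n)
      sums (4 * elliptic_E k / pi - 2 * elliptic_K k / pi)"
    using k by (intro sums_diff elliptic_E_sums) auto
  \<comment> \<open>With y = k^2: (4 n + 2) (1 - y) - 1 = 4 (1 - y) n + 1 - 2 y.\<close>
  moreover have "K_coeff n * (4 * real n + 2) * (k\<^sup>2) ^ n * (1 - k\<^sup>2) - K_coeff n * (k\<^sup>2) ^ n
      = (pochhammer (1/2) n)\<^sup>2 / (fact n)\<^sup>2 * k ^ (2 * n) *
          (4 * (1 - k\<^sup>2) * real n + 1 - 2 * k\<^sup>2)" for n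
    unfolding K_coeff_def power_divide power_mult by (simp only: algebra_simps)
  ultimately show ?thesis
    by (simp add: sums_iff)
qed

end
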